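(* Let $G=(V,E)$ be an infinite, connected, locally finite graph, let $\mathbb{P}_p$ be the law of i.i.d. Bernoulli$(p)$ site percolation on $G$, and let $\mathcal{A}_1$ be the event that there is a unique infinite open cluster. Then for every $u,v\in V$, \[ \mathbb{P}_p(u\leftrightarrow v)\ \ge\ \mathbb{P}_p(u\leftrightarrow\infty)\,\mathbb{P}_p(v\leftrightarrow\infty)\,\mathbb{P}_p(\mathcal{A}_1). \]
   Context: In Bernoulli$(p)$ site percolation each vertex is independently open with probability $p$ and closed otherwise; open clusters are the connected components of the subgraph induced by open vertices. $u\leftrightarrow v$ is the event that $u$ and $v$ are joined by a path all of whose vertices (including $u$ and $v$) are open. $u\leftrightarrow\infty$ is the event that $u$ belongs to an infinite open cluster. *)

theory Defs
  imports "HOL-Probability.Probability" "Graph_Theory.Graph_Theory"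
begin

text \<open>
  An undirected graph is a symmetric digraph (locale \<^locale>\<open>sym_digraph\<close>), whose vertex and arc sets
  may be infinite.  Loops and parallel arcs are not excluded.
\<close>

definition locally_finite :: "('a, 'b) pre_digraph \<Rightarrow> bool" where
  "locally_finite G \<longleftrightarrow> (\<forall>v \<in> verts G. finite (out_arcs G v))"

text \<open>
  A configuration \<open>\<omega>\<close> tells for each vertex whether it is open.
\<close>

definition site_percolation :: "('a, 'b) pre_digraph \<Rightarrow> real \<Rightarrow> ('a \<Rightarrow> bool) measure" where
  "site_percolation G p = (\<Pi>\<^sub>M v \<in> verts G. measure_pmf (bernoulli_pmf p))"

definition open_subgraph :: "('a, 'b) pre_digraph \<Rightarrow> ('a \<Rightarrow> bool) \<Rightarrow> ('a, 'b) pre_digraph" where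
  "open_subgraph G \<omega> = G \<restriction> {v \<in> verts G. \<omega> v}"

text \<open>
  For a symmetric digraph the strongly connected components are the connected components.
\<close>

definition open_clusters :: "('a, 'b) pre_digraph \<Rightarrow> ('a \<Rightarrow> bool) \<Rightarrow> ('a, 'b) pre_digraph set" where
  "open_clusters G \<omega> = pre_digraph.sccs (open_subgraph G \<omega>)"

definition infinite_open_cluster ::
    "('a, 'b) pre_digraph \<Rightarrow> ('a \<Rightarrow> bool) \<Rightarrow> ('a, 'b) pre_digraph \<Rightarrow> bool" where
  "infinite_open_cluster G \<omega> C \<longleftrightarrow> C \<in> open_clusters G \<omega> \<and> infinite (verts C)"

text \<open>
  The list \<open>awalk_verts u q\<close> contains both endpoints; for \<open>u = v\<close> the empty path \<open>q = []\<close> is allowed,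
  and its only vertex is \<open>u\<close>.
\<close>

definition open_connected ::
    "('a, 'b) pre_digraph \<Rightarrow> ('a \<Rightarrow> bool) \<Rightarrow> 'a \<Rightarrow> 'a \<Rightarrow> bool" where
  "open_connected G \<omega> u v \<longleftrightarrow>
     (\<exists>q. pre_digraph.apath G u q v \<and> (\<forall>x \<in> set (pre_digraph.awalk_verts G u q). \<omega> x))"

definition connected_to_infinity ::
    "('a, 'b) pre_digraph \<Rightarrow> ('a \<Rightarrow> bool) \<Rightarrow> 'a \<Rightarrow> bool" where
  "connected_to_infinity G \<omega> u \<longleftrightarrow> (\<exists>C. infinite_open_cluster G \<omega> C \<and> u \<in> verts C)"

definition unique_infinite_cluster :: "('a, 'b) pre_digraph \<Rightarrow> ('a \<Rightarrow> bool) \<Rightarrow> bool" where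
  "unique_infinite_cluster G \<omega> \<longleftrightarrow> (\<exists>!C. infinite_open_cluster G \<omega> C)"

end

theory Submission
  imports Defs
begin

text \<open>
  If \<open>u\<close> and \<open>v\<close> both lie in infinite open clusters and there is only one such cluster, then
  \<open>u\<close> and \<open>v\<close> are connected.  So it suffices that the three events \<open>u \<leftrightarrow> \<infinity>\<close>, \<open>v \<leftrightarrow> \<infinity>\<close> and
  \<open>\<A>\<^sub>1\<close> are positively correlated.  The difficulty is that \<open>\<A>\<^sub>1\<close> is not an increasing event:
  opening infinitely many vertices can create a second infinite cluster.

  However, opening a \<^emph>\<open>single\<close> vertex \<open>x\<close> preserves \<open>\<A>\<^sub>1\<close>.  It only merges \<open>x\<close> with the
  clusters of its neighbours, of which there are finitely many; hence a cluster that is infinite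
  afterwards contains a vertex whose cluster was infinite before
  (\<open>infinite_cluster_before_opening\<close>), and all such vertices were already connected
  (\<open>unique_infinite_cluster_opening\<close>).

  Harris' inequality holds under this weaker monotonicity (\<open>harris_inequality\<close>).  Let
  \<open>f\<^sub>n\<close> be the conditional expectation of \<open>f\<close> given the states of all but the first \<open>n\<close> vertices
  in an enumeration.  Averaging over one vertex at a time, with Chebyshev's sum inequality at each
  of them, gives \<open>\<integral> f g \<ge> \<integral> f\<^sub>n g\<^sub>n\<close> for every \<open>n\<close>, and here only configurations that differ in
  one vertex are ever compared.  In \<open>L\<^sup>1\<close>, \<open>f\<^sub>n\<close> tends to the constant \<open>\<integral> f\<close>
  (\<open>averages_out_indicator\<close>), so the right-hand side tends to \<open>\<integral> f \<integral> g\<close>.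
\<close>

section \<open>Harris' inequality on countable Bernoulli products\<close>

locale bernoulli_product =
  fixes V :: "'v set" and p :: real
  assumes countable_V: "countable V" and nonempty_V: "V \<noteq> {}"
    and p_nonneg: "0 \<le> p" and p_le_1: "p \<le> 1"
begin

definition M :: "('v \<Rightarrow> bool) measure" where
  "M = (\<Pi>\<^sub>M v \<in> V. measure_pmf (bernoulli_pmf p))"

sublocale prob_space M
  unfolding M_def by (intro prob_space_PiM measure_pmf.prob_space_axioms)

lemma fun_upd_in_space: "\<eta> \<in> space M \<Longrightarrow> i \<in> V \<Longrightarrow> \<eta>(i := b) \<in> space M"
  by (auto simp: M_def space_PiM PiE_iff extensional_def)

text \<open>
  The conditional expectation given the states of all vertices other than \<open>i\<close>.
\<close>

definition resample :: "'v \<Rightarrow> (('v \<Rightarrow> bool) \<Rightarrow> real) \<Rightarrow> ('v \<Rightarrow> bool) \<Rightarrow> real" where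
  "resample i f \<eta> = p * f (\<eta>(i := True)) + (1 - p) * f (\<eta>(i := False))"

lemma resample_linear:
  "resample i (\<lambda>\<eta>. a * f \<eta> + b * g \<eta>) \<eta> = a * resample i f \<eta> + b * resample i g \<eta>"
  by (simp add: resample_def algebra_simps)

text \<open>
  Replacing the state of \<open>i\<close> by an independent copy of it does not change the product measure.
\<close>

lemma resample_integral:
  assumes i: "i \<in> V" and f: "integrable M f"
  shows "integrable M (resample i f)" and "(\<integral>\<eta>. resample i f \<eta> \<partial>M) = (\<integral>\<eta>. f \<eta> \<partial>M)"
proof -
  let ?B = "measure_pmf (bernoulli_pmf p)"
  let ?u = "\<lambda>(x, \<eta>). \<eta>(i := x)"
  interpret B: prob_space ?B by (rule measure_pmf.prob_space_axioms)
  interpret BM: pair_prob_space ?B M ..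
  have distr: "distr (?B \<Otimes>\<^sub>M M) M ?u = M"
    using distr_pair_PiM_eq_PiM[of V "\<lambda>_. ?B" i] i
    by (simp add: M_def insert_absorb measure_pmf.prob_space_axioms)
  have "(\<lambda>x. (snd x)(i := fst x)) \<in> ?B \<Otimes>\<^sub>M M \<rightarrow>\<^sub>M M"
    unfolding M_def using i by (intro measurable_fun_upd[where J = V]) auto
  then have meas: "?u \<in> ?B \<Otimes>\<^sub>M M \<rightarrow>\<^sub>M M"
    by (simp add: case_prod_beta')
  have int: "integrable (?B \<Otimes>\<^sub>M M) (case_prod (\<lambda>x \<eta>. f (\<eta>(i := x))))"
    using integrable_distr[OF meas, of f] f distr by (simp add: case_prod_beta')
  have inner: "(\<integral>x. f (\<eta>(i := x)) \<partial>?B) = resample i f \<eta>" for \<eta>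
    using p_nonneg p_le_1 by (simp add: resample_def mult.commute)
  show "integrable M (resample i f)"
    using BM.integrable_snd[OF int] unfolding inner .
  have "(\<integral>\<eta>. f \<eta> \<partial>M) = (\<integral>\<eta>. f \<eta> \<partial>distr (?B \<Otimes>\<^sub>M M) M ?u)"
    by (simp add: distr)
  also have "\<dots> = (\<integral>z. f (?u z) \<partial>(?B \<Otimes>\<^sub>M M))"
    using meas f by (intro integral_distr) auto
  also have "\<dots> = (\<integral>\<eta>. resample i f \<eta> \<partial>M)"
    using BM.integral_snd[OF int] unfolding inner by (simp add: case_prod_beta')
  finally show "(\<integral>\<eta>. resample i f \<eta> \<partial>M) = (\<integral>\<eta>. f \<eta> \<partial>M)" by simp
qed

text \<open>
  Only configurations that differ in a single vertex are compared.  For functions of infinitely many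
  states this is weaker than monotonicity in the pointwise order.
\<close>

definition increasing :: "(('v \<Rightarrow> bool) \<Rightarrow> real) \<Rightarrow> bool" where
  "increasing f \<longleftrightarrow> (\<forall>\<eta> \<in> space M. \<forall>i \<in> V. f (\<eta>(i := False)) \<le> f (\<eta>(i := True)))"

lemma increasing_resample:
  assumes f: "increasing f" and i: "i \<in> V"
  shows "increasing (resample i f)"
  unfolding increasing_def
proof (intro ballI)
  fix \<eta> j assume \<eta>: "\<eta> \<in> space M" and j: "j \<in> V"
  show "resample i f (\<eta>(j := False)) \<le> resample i f (\<eta>(j := True))"
  proof (cases "j = i")
    case True
    then show ?thesis by (simp add: resample_def)
  next
    case False
    have "f (\<eta>(i := b, j := False)) \<le> f (\<eta>(i := b, j := True))" for b
      using f fun_upd_in_space[OF \<eta> i] j by (auto simp: increasing_def)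
    then show ?thesis
      using False p_nonneg p_le_1
      by (auto simp: resample_def fun_upd_twist[of j i] intro!: add_mono mult_left_mono)
  qed
qed

text \<open>
  On the two states of a single vertex, this is Chebyshev's sum inequality.
\<close>

lemma resample_mult_le:
  assumes "increasing f" "increasing g" "\<eta> \<in> space M" "i \<in> V"
  shows "resample i f \<eta> * resample i g \<eta> \<le> resample i (\<lambda>\<eta>. f \<eta> * g \<eta>) \<eta>"
proof -
  have "resample i (\<lambda>\<eta>. f \<eta> * g \<eta>) \<eta> - resample i f \<eta> * resample i g \<eta>
      = (p * (1 - p)) * ((f (\<eta>(i := True)) - f (\<eta>(i := False))) *
          (g (\<eta>(i := True)) - g (\<eta>(i := False))))"
    by (simp add: resample_def algebra_simps)
  also have "\<dots> \<ge> 0"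
    using assms p_nonneg p_le_1 by (intro mult_nonneg_nonneg) (auto simp: increasing_def)
  finally show ?thesis by simp
qed

text \<open>
  The conditional expectation given the states of all vertices other than the first \<open>n\<close>.  If \<open>V\<close>
  is finite, the enumeration repeats vertices, which is harmless because \<open>resample i\<close> is idempotent.
\<close>

fun resample_upto :: "nat \<Rightarrow> (('v \<Rightarrow> bool) \<Rightarrow> real) \<Rightarrow> ('v \<Rightarrow> bool) \<Rightarrow> real" where
  "resample_upto 0 f = f"
| "resample_upto (Suc n) f = resample (from_nat_into V n) (resample_upto n f)"

lemma enum_in_V: "from_nat_into V n \<in> V"
  using nonempty_V by (rule from_nat_into)

lemma resample_upto_linear:
  "resample_upto n (\<lambda>\<eta>. a * f \<eta> + b * g \<eta>) = (\<lambda>\<eta>. a * resample_upto n f \<eta> + b * resample_upto n g \<eta>)"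
  by (induction n) (auto simp: resample_linear)

lemma resample_upto_integral:
  assumes "integrable M f"
  shows "integrable M (resample_upto n f)" and "(\<integral>\<eta>. resample_upto n f \<eta> \<partial>M) = (\<integral>\<eta>. f \<eta> \<partial>M)"
  using assms by (induction n) (simp_all add: resample_integral enum_in_V)

lemma resample_upto_L1_contraction:
  assumes f: "integrable M f"
  shows "(\<integral>\<eta>. \<bar>resample_upto n f \<eta>\<bar> \<partial>M) \<le> (\<integral>\<eta>. \<bar>f \<eta>\<bar> \<partial>M)"
proof (induction n)
  case (Suc n)
  let ?g = "resample_upto n f" and ?i = "from_nat_into V n"
  have g: "integrable M ?g" by (rule resample_upto_integral[OF f])
  have "(\<integral>\<eta>. \<bar>resample ?i ?g \<eta>\<bar> \<partial>M) \<le> (\<integral>\<eta>. resample ?i (\<lambda>\<eta>. \<bar>?g \<eta>\<bar>) \<eta> \<partial>M)"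
  proof (rule integral_mono)
    show "integrable M (\<lambda>\<eta>. \<bar>resample ?i ?g \<eta>\<bar>)"
      using resample_integral(1)[OF enum_in_V g] by simp
    show "integrable M (resample ?i (\<lambda>\<eta>. \<bar>?g \<eta>\<bar>))"
      using g by (intro resample_integral enum_in_V) simp
    show "\<bar>resample ?i ?g \<eta>\<bar> \<le> resample ?i (\<lambda>\<eta>. \<bar>?g \<eta>\<bar>) \<eta>" for \<eta>
      unfolding resample_def using p_nonneg p_le_1
      by (intro order_trans[OF abs_triangle_ineq]) (simp add: abs_mult)
  qed
  also have "\<dots> = (\<integral>\<eta>. \<bar>?g \<eta>\<bar> \<partial>M)"
    using g by (intro resample_integral enum_in_V) simp
  finally show ?case using Suc by simp
qed simp

text \<open>
  What a quantitative form of Kolmogorov's zero-one law says about \<open>f\<close>: the conditional expectation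
  given the states outside a growing finite set of vertices tends to the mean in \<open>L\<^sup>1\<close>.
\<close>

definition averages_out :: "(('v \<Rightarrow> bool) \<Rightarrow> real) \<Rightarrow> bool" where
  "averages_out f \<longleftrightarrow> integrable M f \<and>
     (\<lambda>n. \<integral>\<eta>. \<bar>resample_upto n f \<eta> - (\<integral>\<eta>'. f \<eta>' \<partial>M)\<bar> \<partial>M) \<longlonglongrightarrow> 0"

lemma averages_out_linear:
  assumes f: "averages_out f" and g: "averages_out g"
  shows "averages_out (\<lambda>\<eta>. a * f \<eta> + b * g \<eta>)"
proof -
  have i: "integrable M f" "integrable M g"
    using f g by (simp_all add: averages_out_def)
  note it = resample_upto_integral(1)[OF i(1)] resample_upto_integral(1)[OF i(2)]
  let ?D = "\<lambda>f n. \<integral>\<eta>. \<bar>resample_upto n f \<eta> - (\<integral>\<eta>'. f \<eta>' \<partial>M)\<bar> \<partial>M"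
  have le: "?D (\<lambda>\<eta>. a * f \<eta> + b * g \<eta>) n \<le> \<bar>a\<bar> * ?D f n + \<bar>b\<bar> * ?D g n" for n
  proof -
    have "?D (\<lambda>\<eta>. a * f \<eta> + b * g \<eta>) n \<le>
      (\<integral>\<eta>. \<bar>a\<bar> * \<bar>resample_upto n f \<eta> - (\<integral>\<eta>'. f \<eta>' \<partial>M)\<bar> + \<bar>b\<bar> * \<bar>resample_upto n g \<eta> - (\<integral>\<eta>'. g \<eta>' \<partial>M)\<bar> \<partial>M)"
    proof (rule integral_mono)
      fix \<eta>
      have "\<bar>a * (resample_upto n f \<eta> - (\<integral>\<eta>'. f \<eta>' \<partial>M)) + b * (resample_upto n g \<eta> - (\<integral>\<eta>'. g \<eta>' \<partial>M))\<bar>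
        \<le> \<bar>a\<bar> * \<bar>resample_upto n f \<eta> - (\<integral>\<eta>'. f \<eta>' \<partial>M)\<bar> + \<bar>b\<bar> * \<bar>resample_upto n g \<eta> - (\<integral>\<eta>'. g \<eta>' \<partial>M)\<bar>"
        by (rule order_trans[OF abs_triangle_ineq]) (simp add: abs_mult)
      then show "\<bar>resample_upto n (\<lambda>\<eta>. a * f \<eta> + b * g \<eta>) \<eta> - (\<integral>\<eta>'. a * f \<eta>' + b * g \<eta>' \<partial>M)\<bar>
        \<le> \<bar>a\<bar> * \<bar>resample_upto n f \<eta> - (\<integral>\<eta>'. f \<eta>' \<partial>M)\<bar> + \<bar>b\<bar> * \<bar>resample_upto n g \<eta> - (\<integral>\<eta>'. g \<eta>' \<partial>M)\<bar>"
        using i by (simp add: resample_upto_linear algebra_simps)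
    qed (use i it in \<open>simp_all add: resample_upto_linear\<close>)
    also have "\<dots> = \<bar>a\<bar> * ?D f n + \<bar>b\<bar> * ?D g n"
      using it by simp
    finally show ?thesis .
  qed
  have lim: "(\<lambda>n. \<bar>a\<bar> * ?D f n + \<bar>b\<bar> * ?D g n) \<longlonglongrightarrow> 0"
    using f g by (auto simp: averages_out_def intro!: tendsto_eq_intros)
  have "?D (\<lambda>\<eta>. a * f \<eta> + b * g \<eta>) \<longlonglongrightarrow> 0"
    by (rule tendsto_sandwich[OF _ _ tendsto_const lim]) (auto intro!: always_eventually le)
  then show ?thesis
    using i by (simp add: averages_out_def)
qed

text \<open>
  The \<open>L\<^sup>1\<close> contraction property of \<open>resample_upto\<close> makes the error of the approximation uniform
  in \<open>n\<close>.
\<close>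

lemma averages_out_L1_limit:
  assumes f: "integrable M f"
    and approx: "\<And>\<epsilon>. \<epsilon> > 0 \<Longrightarrow> \<exists>g. averages_out g \<and> (\<integral>\<eta>. \<bar>f \<eta> - g \<eta>\<bar> \<partial>M) \<le> \<epsilon>"
  shows "averages_out f"
proof -
  let ?D = "\<lambda>f n. \<integral>\<eta>. \<bar>resample_upto n f \<eta> - (\<integral>\<eta>'. f \<eta>' \<partial>M)\<bar> \<partial>M"
  have "?D f \<longlonglongrightarrow> 0"
  proof (rule LIMSEQ_I)
    fix \<epsilon> :: real assume "\<epsilon> > 0"
    then obtain g where g: "averages_out g" and fg: "(\<integral>\<eta>. \<bar>f \<eta> - g \<eta>\<bar> \<partial>M) \<le> \<epsilon> / 4"
      using approx[of "\<epsilon> / 4"] by auto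
    \<comment> \<open>Replacing \<open>f\<close> by \<open>g\<close> costs \<open>\<epsilon> / 4\<close> in the resampled function and \<open>\<epsilon> / 4\<close> in the mean.\<close>
    have ig: "integrable M g" using g by (simp add: averages_out_def)
    have ifg: "integrable M (\<lambda>\<eta>. f \<eta> - g \<eta>)" using f ig by simp
    note it = resample_upto_integral(1)[OF f] resample_upto_integral(1)[OF ig]
    have diff: "resample_upto n f \<eta> - resample_upto n g \<eta> = resample_upto n (\<lambda>\<eta>. f \<eta> - g \<eta>) \<eta>" for n \<eta>
      using resample_upto_linear[of n 1 f "-1" g] by simp
    have mean: "\<bar>(\<integral>\<eta>. f \<eta> \<partial>M) - (\<integral>\<eta>. g \<eta> \<partial>M)\<bar> \<le> \<epsilon> / 4"
      using integral_abs_bound[of M "\<lambda>\<eta>. f \<eta> - g \<eta>"] fg f ig by simp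
    have le: "?D f n \<le> \<epsilon> / 2 + ?D g n" for n
    proof -
      have "?D f n \<le> (\<integral>\<eta>. \<bar>resample_upto n f \<eta> - resample_upto n g \<eta>\<bar>
          + \<bar>resample_upto n g \<eta> - (\<integral>\<eta>'. g \<eta>' \<partial>M)\<bar> + \<epsilon> / 4 \<partial>M)"
      proof (rule integral_mono)
        fix \<eta> show "\<bar>resample_upto n f \<eta> - (\<integral>\<eta>'. f \<eta>' \<partial>M)\<bar> \<le> \<bar>resample_upto n f \<eta> - resample_upto n g \<eta>\<bar>
          + \<bar>resample_upto n g \<eta> - (\<integral>\<eta>'. g \<eta>' \<partial>M)\<bar> + \<epsilon> / 4"
          using mean by linarith
      qed (use it in simp_all)
      also have "\<dots> = (\<integral>\<eta>. \<bar>resample_upto n (\<lambda>\<eta>. f \<eta> - g \<eta>) \<eta>\<bar> \<partial>M) + ?D g n + \<epsilon> / 4"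
        using it by (simp add: diff[symmetric] prob_space)
      also have "\<dots> \<le> \<epsilon> / 2 + ?D g n"
        using resample_upto_L1_contraction[OF ifg, of n] fg by simp
      finally show ?thesis .
    qed
    have "?D g \<longlonglongrightarrow> 0" using g by (simp add: averages_out_def)
    then obtain N where N: "\<forall>n\<ge>N. \<bar>?D g n\<bar> < \<epsilon> / 2"
      using \<open>\<epsilon> > 0\<close> by (auto dest!: LIMSEQ_D[of _ _ "\<epsilon> / 2"])
    have "\<bar>?D f n\<bar> < \<epsilon>" if "n \<ge> N" for n
    proof -
      have "?D f n \<ge> 0" by simp
      then show ?thesis using le[of n] N[rule_format, OF that] by linarith
    qed
    then show "\<exists>N. \<forall>n\<ge>N. norm (?D f n - 0) < \<epsilon>" by auto
  qed
  then show ?thesis using f by (simp add: averages_out_def)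
qed

definition depends_on :: "'v set \<Rightarrow> (('v \<Rightarrow> bool) \<Rightarrow> real) \<Rightarrow> bool" where
  "depends_on J f \<longleftrightarrow>
     (\<forall>\<eta> \<in> space M. \<forall>\<eta>' \<in> space M. (\<forall>j \<in> J. \<eta> j = \<eta>' j) \<longrightarrow> f \<eta> = f \<eta>')"

lemma depends_on_resample:
  assumes f: "depends_on J f" and i: "i \<in> V"
  shows "depends_on (J - {i}) (resample i f)"
  unfolding depends_on_def
proof (intro ballI impI)
  fix \<eta> \<eta>' assume \<eta>: "\<eta> \<in> space M" "\<eta>' \<in> space M" and eq: "\<forall>j \<in> J - {i}. \<eta> j = \<eta>' j"
  have "f (\<eta>(i := b)) = f (\<eta>'(i := b))" for b
    using f[unfolded depends_on_def, rule_format, OF fun_upd_in_space[OF \<eta>(1) i] fun_upd_in_space[OF \<eta>(2) i]] eq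
    by simp
  then show "resample i f \<eta> = resample i f \<eta>'"
    by (simp add: resample_def)
qed

lemma depends_on_resample_upto:
  "depends_on J f \<Longrightarrow> depends_on (J - from_nat_into V ` {..<n}) (resample_upto n f)"
proof (induction n)
  case (Suc n)
  have "J - from_nat_into V ` {..<Suc n} = J - from_nat_into V ` {..<n} - {from_nat_into V n}"
    by (auto simp: lessThan_Suc)
  then show ?case
    using depends_on_resample[OF Suc.IH[OF Suc.prems] enum_in_V] by simp
qed simp

text \<open>
  Once all vertices of \<open>J\<close> have been resampled, the function has become a constant.
\<close>

lemma averages_out_if_finite_dependence:
  assumes f: "integrable M f" and J: "finite J" "J \<subseteq> V" and dep: "depends_on J f"
  shows "averages_out f"
proof -
  let ?D = "\<lambda>n. \<integral>\<eta>. \<bar>resample_upto n f \<eta> - (\<integral>\<eta>'. f \<eta>' \<partial>M)\<bar> \<partial>M"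
  have "\<exists>N. J \<subseteq> from_nat_into V ` {..<N}"
  proof -
    have "J \<subseteq> range (from_nat_into V)"
      using J(2) range_from_nat_into[OF nonempty_V countable_V] by simp
    then obtain C where C: "finite C" "J = from_nat_into V ` C"
      using finite_subset_image[OF J(1)] by blast
    then show ?thesis using finite_nat_bounded[OF C(1)] by blast
  qed
  then obtain N where N: "J \<subseteq> from_nat_into V ` {..<N}" by blast
  have "?D n = 0" if n: "n \<ge> N" for n
  proof -
    have "J \<subseteq> from_nat_into V ` {..<n}" using N n by fastforce
    then have all: "J - from_nat_into V ` {..<n} = {}" by blast
    then have dep0: "depends_on {} (resample_upto n f)"
      using depends_on_resample_upto[OF dep, of n] by (simp only: all)
    obtain \<eta>\<^sub>0 where \<eta>\<^sub>0: "\<eta>\<^sub>0 \<in> space M" using not_empty by blast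
    have const: "resample_upto n f \<eta> = resample_upto n f \<eta>\<^sub>0" if "\<eta> \<in> space M" for \<eta>
      using dep0[unfolded depends_on_def, rule_format, OF that \<eta>\<^sub>0] by blast
    have "(\<integral>\<eta>. f \<eta> \<partial>M) = (\<integral>\<eta>. resample_upto n f \<eta>\<^sub>0 \<partial>M)"
      unfolding resample_upto_integral(2)[OF f, of n, symmetric]
      by (rule Bochner_Integration.integral_cong[OF refl const])
    then have mean: "(\<integral>\<eta>. f \<eta> \<partial>M) = resample_upto n f \<eta>\<^sub>0" by (simp add: prob_space)
    have "?D n = (\<integral>\<eta>. 0 \<partial>M)"
      by (rule Bochner_Integration.integral_cong) (simp_all add: const mean)
    then show ?thesis by simp
  qed
  then have "?D \<longlonglongrightarrow> 0"
    by (intro tendsto_eventually) (auto simp: eventually_sequentially)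
  then show ?thesis using f by (simp add: averages_out_def)
qed

text \<open>
  Dynkin's \<open>\<pi>\<close>-\<open>\<lambda>\<close> theorem: the events with this property contain the finite-dimensional boxes and
  form a Dynkin system, as the property is linear and closed under \<open>L\<^sup>1\<close> limits.
\<close>

lemma averages_out_indicator:
  assumes "A \<in> sets M"
  shows "averages_out (indicator A)"
proof -
  let ?P = "prod_algebra V (\<lambda>_. measure_pmf (bernoulli_pmf p))"
  have sets_M: "sets M = sigma_sets (space M) ?P"
    by (simp add: M_def sets_PiM space_PiM)
  have P_sub: "?P \<subseteq> Pow (space M)"
    using prod_algebra_sets_into_space[of V "\<lambda>_. measure_pmf (bernoulli_pmf p)"]
    by (simp add: M_def space_PiM)
  have ind: "integrable M (indicator B :: _ \<Rightarrow> real)" if "B \<in> sets M" for B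
    using that by (simp add: integrable_indicator_iff less_top[symmetric])
  have "A \<in> sigma_sets (space M) ?P" using assms by (simp only: sets_M)
  with Int_stable_prod_algebra P_sub show ?thesis
  proof (induction rule: sigma_sets_induct_disjoint)
    case (basic B)
    then obtain J X where B: "B = prod_emb V (\<lambda>_. measure_pmf (bernoulli_pmf p)) J (\<Pi>\<^sub>E j\<in>J. X j)"
      and J: "finite J" "J \<subseteq> V"
      by (elim prod_algebraE) auto
    have "\<eta> \<in> B \<longleftrightarrow> (\<forall>j\<in>J. \<eta> j \<in> X j)" if "\<eta> \<in> space M" for \<eta>
      using that by (auto simp: B prod_emb_def M_def space_PiM)
    then have "depends_on J (indicator B)"
      by (auto simp: depends_on_def indicator_def)
    moreover have "B \<in> sets M" using basic by (simp add: sets_M)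
    ultimately show ?case using J by (intro averages_out_if_finite_dependence ind)
  next
    case empty
    show ?case
      by (rule averages_out_if_finite_dependence[of _ "{}"]) (auto simp: depends_on_def)
  next
    case (compl B)
    have one: "averages_out (\<lambda>_. 1)"
      by (rule averages_out_if_finite_dependence[of _ "{}"]) (auto simp: depends_on_def)
    have B: "B \<in> sets M" using compl by (simp add: sets_M)
    show ?case
    proof (rule averages_out_L1_limit)
      show "integrable M (indicator (space M - B) :: _ \<Rightarrow> real)" using B by (intro ind) auto
      fix \<epsilon> :: real assume "\<epsilon> > 0"
      \<comment> \<open>The two functions agree on \<open>space M\<close> only, so they are compared in \<open>L\<^sup>1\<close>.\<close>
      have "(\<integral>\<eta>. \<bar>indicator (space M - B) \<eta> - (1 * 1 + (- 1) * indicator B \<eta> :: real)\<bar> \<partial>M) = (\<integral>\<eta>. 0 \<partial>M)"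
        by (rule Bochner_Integration.integral_cong) (auto simp: indicator_def)
      with \<open>\<epsilon> > 0\<close> show "\<exists>g. averages_out g \<and> (\<integral>\<eta>. \<bar>indicator (space M - B) \<eta> - g \<eta>\<bar> \<partial>M) \<le> \<epsilon>"
        by (intro exI[of _ "\<lambda>\<eta>. 1 * 1 + (- 1) * indicator B \<eta>"] conjI averages_out_linear one compl.IH) simp
    qed
  next
    case (union B)
    have B: "B k \<in> sets M" for k using union by (auto simp: sets_M)
    have disj: "disjoint_family B" and IH: "averages_out (indicator (B k))" for k
      using union by simp_all
    show ?case
    proof (rule averages_out_L1_limit)
      show "integrable M (indicator (\<Union>i. B i) :: _ \<Rightarrow> real)" using B by (intro ind) auto
      fix \<epsilon> :: real assume "\<epsilon> > 0"
      have "(\<lambda>k. prob (B k)) sums prob (\<Union>i. B i)"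
        using B disj by (intro finite_measure_UNION) (auto simp: disjoint_family_on_def)
      then obtain k where k: "\<bar>(\<Sum>i<k. prob (B i)) - prob (\<Union>i. B i)\<bar> < \<epsilon>"
        using \<open>\<epsilon> > 0\<close> by (auto simp: sums_def dest!: LIMSEQ_D[of _ _ \<epsilon>])
      let ?g = "\<lambda>k \<eta>. \<Sum>i<k. indicator (B i) \<eta> :: real"
      have g: "averages_out (?g k)" for k
      proof (induction k)
        case 0
        show ?case
          by (rule averages_out_if_finite_dependence[of _ "{}"]) (auto simp: depends_on_def)
      next
        case (Suc k)
        show ?case using averages_out_linear[OF Suc IH[of k], of 1 1] by (simp add: add.commute)
      qed
      have eq: "?g k \<eta> = indicator (\<Union>i<k. B i) \<eta>" for \<eta>
        using disj by (subst indicator_UN_disjoint) (auto simp: disjoint_family_on_def)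
      have "(\<integral>\<eta>. \<bar>indicator (\<Union>i. B i) \<eta> - ?g k \<eta>\<bar> \<partial>M) = (\<integral>\<eta>. indicator (\<Union>i. B i) \<eta> - ?g k \<eta> \<partial>M)"
        unfolding eq by (rule Bochner_Integration.integral_cong) (auto simp: indicator_def)
      also have "\<dots> = prob (\<Union>i. B i) - (\<Sum>i<k. prob (B i))"
        using B by (subst Bochner_Integration.integral_diff) (auto simp: ind)
      finally have "(\<integral>\<eta>. \<bar>indicator (\<Union>i. B i) \<eta> - ?g k \<eta>\<bar> \<partial>M) \<le> \<epsilon>"
        using k by simp
      with g show "\<exists>g. averages_out g \<and> (\<integral>\<eta>. \<bar>indicator (\<Union>i. B i) \<eta> - g \<eta>\<bar> \<partial>M) \<le> \<epsilon>" by blast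
    qed
  qed
qed

text \<open>
  Bounds that \<open>resample\<close> and products preserve, so that all integrands below are integrable.
\<close>

definition unit_function :: "(('v \<Rightarrow> bool) \<Rightarrow> real) \<Rightarrow> bool" where
  "unit_function f \<longleftrightarrow> f \<in> borel_measurable M \<and> (\<forall>\<eta> \<in> space M. 0 \<le> f \<eta> \<and> f \<eta> \<le> 1)"

lemma unit_function_integrable: "unit_function f \<Longrightarrow> integrable M f"
  by (rule integrable_const_bound[where B = 1]) (auto simp: unit_function_def)

lemma unit_function_mult: "unit_function f \<Longrightarrow> unit_function g \<Longrightarrow> unit_function (\<lambda>\<eta>. f \<eta> * g \<eta>)"
  by (auto simp: unit_function_def mult_le_one)

lemma unit_function_resample:
  assumes f: "unit_function f" and i: "i \<in> V"
  shows "unit_function (resample i f)"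
  unfolding unit_function_def
proof (intro conjI ballI)
  show "resample i f \<in> borel_measurable M"
    using resample_integral(1)[OF i unit_function_integrable[OF f]] by simp
  fix \<eta> assume \<eta>: "\<eta> \<in> space M"
  have *: "0 \<le> f (\<eta>(i := b))" "f (\<eta>(i := b)) \<le> 1" for b
    using f fun_upd_in_space[OF \<eta> i] by (auto simp: unit_function_def)
  show "0 \<le> resample i f \<eta>" using * p_nonneg p_le_1 by (simp add: resample_def)
  have "p * f (\<eta>(i := True)) + (1 - p) * f (\<eta>(i := False)) \<le> p * 1 + (1 - p) * 1"
    using * p_nonneg p_le_1 by (intro add_mono mult_left_mono) auto
  then show "resample i f \<eta> \<le> 1" by (simp add: resample_def)
qed

lemma resample_upto_preserves:
  "unit_function f \<Longrightarrow> unit_function (resample_upto n f)"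
  "increasing f \<Longrightarrow> increasing (resample_upto n f)"
  by (induction n) (auto intro: unit_function_resample increasing_resample enum_in_V)

text \<open>
  Resampling one more vertex does not change \<open>\<integral> f g\<close>, but replacing the average of the product by
  the product of the averages can only decrease it.
\<close>

lemma integral_resample_upto_mult_le:
  assumes f: "unit_function f" "increasing f" and g: "unit_function g" "increasing g"
  shows "(\<integral>\<eta>. resample_upto n f \<eta> * resample_upto n g \<eta> \<partial>M) \<le> (\<integral>\<eta>. f \<eta> * g \<eta> \<partial>M)"
proof (induction n)
  case (Suc n)
  let ?f = "resample_upto n f" and ?g = "resample_upto n g" and ?i = "from_nat_into V n"
  note pres = resample_upto_preserves[of _ n]
  have fg: "unit_function (\<lambda>\<eta>. ?f \<eta> * ?g \<eta>)" by (intro unit_function_mult pres f g)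
  have "(\<integral>\<eta>. resample ?i ?f \<eta> * resample ?i ?g \<eta> \<partial>M) \<le> (\<integral>\<eta>. resample ?i (\<lambda>\<eta>. ?f \<eta> * ?g \<eta>) \<eta> \<partial>M)"
    by (intro integral_mono unit_function_integrable unit_function_mult unit_function_resample
        resample_mult_le pres f g enum_in_V)
  also have "\<dots> = (\<integral>\<eta>. ?f \<eta> * ?g \<eta> \<partial>M)"
    by (intro resample_integral enum_in_V unit_function_integrable fg)
  finally show ?case using Suc by simp
qed simp

definition closed_under_opening :: "('v \<Rightarrow> bool) set \<Rightarrow> bool" where
  "closed_under_opening A \<longleftrightarrow> (\<forall>\<eta> \<in> A. \<forall>i \<in> V. \<eta>(i := True) \<in> A)"

text \<open>
  As \<open>0 \<le> g\<^sub>n \<le> 1\<close> and \<open>g\<^sub>n\<close> has mean \<open>prob B\<close>, the integral \<open>\<integral> f\<^sub>n g\<^sub>n\<close> differs from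
  \<open>prob A * prob B\<close> by at most the \<open>L\<^sup>1\<close> distance of \<open>f\<^sub>n\<close> from its mean.
\<close>

theorem harris_inequality:
  assumes A: "A \<in> sets M" "closed_under_opening A"
    and B: "B \<in> sets M" "closed_under_opening B"
  shows "prob A * prob B \<le> prob (A \<inter> B)"
proof -
  have incr: "increasing (indicator C)" if "closed_under_opening C" for C
    unfolding increasing_def
  proof (intro ballI)
    fix \<eta> i assume "i \<in> V"
    have "\<eta>(i := True) \<in> C" if "\<eta>(i := False) \<in> C"
      using \<open>closed_under_opening C\<close> that \<open>i \<in> V\<close>
      by (metis closed_under_opening_def fun_upd_upd)
    then show "indicator C (\<eta>(i := False)) \<le> (indicator C (\<eta>(i := True)) :: real)"
      by (auto simp: indicator_def)
  qed
  have unit: "unit_function (indicator C)" if "C \<in> sets M" for C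
    using that by (auto simp: unit_function_def)
  let ?f = "\<lambda>n. resample_upto n (indicator A)" and ?g = "\<lambda>n. resample_upto n (indicator B)"
  let ?D = "\<lambda>n. \<integral>\<eta>. \<bar>?f n \<eta> - prob A\<bar> \<partial>M"
  have uf: "unit_function (?f n)" and ug: "unit_function (?g n)" for n
    using A B by (auto intro!: resample_upto_preserves unit)
  have "prob A * prob B - ?D n \<le> prob (A \<inter> B)" for n
  proof -
    have ints: "integrable M (?f n)" "integrable M (?g n)" "integrable M (\<lambda>\<eta>. ?f n \<eta> * ?g n \<eta>)"
      by (intro unit_function_integrable unit_function_mult uf ug)+
    have mean: "(\<integral>\<eta>. ?g n \<eta> \<partial>M) = prob B"
      using resample_upto_integral(2)[OF unit_function_integrable[OF unit[OF B(1)]], of n] B by simp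
    have "prob A * prob B - ?D n = (\<integral>\<eta>. prob A * ?g n \<eta> - \<bar>?f n \<eta> - prob A\<bar> \<partial>M)"
      using ints by (simp add: mean)
    also have "\<dots> \<le> (\<integral>\<eta>. ?f n \<eta> * ?g n \<eta> \<partial>M)"
    proof (rule integral_mono)
      fix \<eta> assume "\<eta> \<in> space M"
      then have "0 \<le> ?g n \<eta>" "?g n \<eta> \<le> 1"
        using ug[of n] by (auto simp: unit_function_def)
      then have "\<bar>?f n \<eta> - prob A\<bar> * ?g n \<eta> \<le> \<bar>?f n \<eta> - prob A\<bar> * 1"
        by (intro mult_left_mono) auto
      moreover have "(prob A - ?f n \<eta>) * ?g n \<eta> \<le> \<bar>?f n \<eta> - prob A\<bar> * ?g n \<eta>"
        using \<open>0 \<le> ?g n \<eta>\<close> by (intro mult_right_mono) auto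
      ultimately show "prob A * ?g n \<eta> - \<bar>?f n \<eta> - prob A\<bar> \<le> ?f n \<eta> * ?g n \<eta>"
        by (simp add: algebra_simps)
    qed (use ints in simp_all)
    also have "\<dots> \<le> (\<integral>\<eta>. indicator A \<eta> * indicator B \<eta> \<partial>M)"
      using A B by (intro integral_resample_upto_mult_le unit incr)
    also have "\<dots> = prob (A \<inter> B)"
      using A B by (simp add: indicator_inter_arith[symmetric])
    finally show ?thesis .
  qed
  moreover have "(\<lambda>n. prob A * prob B - ?D n) \<longlonglongrightarrow> prob A * prob B - 0"
    using averages_out_indicator[OF A(1)] A
    by (intro tendsto_diff tendsto_const) (simp add: averages_out_def)
  ultimately show ?thesis
    by (intro LIMSEQ_le_const2[of "\<lambda>n. prob A * prob B - ?D n"]) auto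
qed

end

section \<open>Open clusters\<close>

context sym_digraph
begin

lemma sym_digraph_open_subgraph: "sym_digraph (open_subgraph G \<eta>)"
  unfolding open_subgraph_def by (rule induced_graph_imp_graph, rule induced_induce) auto

lemma verts_open_subgraph: "verts (open_subgraph G \<eta>) = {v \<in> verts G. \<eta> v}"
  by (simp add: open_subgraph_def)

lemma dominates_open_subgraph_iff:
  "x \<rightarrow>\<^bsub>open_subgraph G \<eta>\<^esub> y \<longleftrightarrow> x \<rightarrow>\<^bsub>G\<^esub> y \<and> \<eta> x \<and> \<eta> y"
  by (auto simp: open_subgraph_def arcs_ends_conv)

text \<open>
  A path with all its vertices open is the same as a path in the induced subgraph; the restriction
  to paths without repeated vertices is immaterial, since every walk can be shortened to a path.
\<close>

lemma open_connected_iff_reachable: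
  "open_connected G \<eta> u v \<longleftrightarrow> u \<rightarrow>\<^sup>*\<^bsub>open_subgraph G \<eta>\<^esub> v"
proof -
  let ?H = "open_subgraph G \<eta>"
  interpret H: sym_digraph ?H by (rule sym_digraph_open_subgraph)
  have vs: "H.awalk_verts u q = awalk_verts u q" for q
    by (simp add: pre_digraph.awalk_verts_conv open_subgraph_def)
  have cas: "H.cas u q v = cas u q v" for q
    by (simp add: open_subgraph_def compatible_cas[OF compatible_induce_subgraph])
  have "H.apath u q v \<longleftrightarrow> apath u q v \<and> (\<forall>x \<in> set (awalk_verts u q). \<eta> x)" for q
  proof
    assume L: "H.apath u q v"
    then have "set (awalk_verts u q) \<subseteq> {v \<in> verts G. \<eta> v}"
      by (auto simp: H.apath_def H.awalk_conv vs verts_open_subgraph)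
    moreover have "apath u q v"
    proof -
      have "u \<in> verts ?H" "set q \<subseteq> arcs ?H" "cas u q v" "distinct (awalk_verts u q)"
        using L by (auto simp: H.apath_def H.awalk_def vs cas)
      then show ?thesis by (auto simp: apath_def awalk_def open_subgraph_def)
    qed
    ultimately show "apath u q v \<and> (\<forall>x \<in> set (awalk_verts u q). \<eta> x)" by auto
  next
    assume R: "apath u q v \<and> (\<forall>x \<in> set (awalk_verts u q). \<eta> x)"
    then have c: "cas u q v" and q: "set q \<subseteq> arcs G" and u: "u \<in> verts G"
      by (auto simp: apath_def awalk_def)
    have "tail G e \<in> set (awalk_verts u q) \<and> head G e \<in> set (awalk_verts u q)" if "e \<in> set q" for e
    proof
      have "q \<noteq> []" using that by auto
      then show "tail G e \<in> set (awalk_verts u q)"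
        using that by (simp add: awalk_verts_conv)
      show "head G e \<in> set (awalk_verts u q)"
        using that \<open>q \<noteq> []\<close> by (simp add: awalk_verts_conv'[OF c])
    qed
    then have "set q \<subseteq> arcs ?H"
      using q R by (auto simp: open_subgraph_def)
    moreover have "u \<in> verts ?H"
      using R u hd_in_set[OF awalk_verts_non_Nil, of u q] awhd_if_cas[OF c]
      by (auto simp: verts_open_subgraph)
    ultimately show "H.apath u q v"
      using R c by (simp add: H.apath_def apath_def H.awalk_def vs cas)
  qed
  then show ?thesis
    by (simp add: open_connected_def H.reachable_apath)
qed

lemma open_connected_refl_iff: "open_connected G \<eta> u u \<longleftrightarrow> u \<in> verts G \<and> \<eta> u"
proof -
  interpret H: sym_digraph "open_subgraph G \<eta>" by (rule sym_digraph_open_subgraph)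
  show ?thesis
    using H.reachable_in_verts H.reachable_refl
    by (auto simp: open_connected_iff_reachable verts_open_subgraph)
qed

lemma open_connected_sym: "open_connected G \<eta> u v \<Longrightarrow> open_connected G \<eta> v u"
  using sym_digraph.symmetric_reachable'[OF sym_digraph_open_subgraph]
  by (simp add: open_connected_iff_reachable)

lemma open_connected_trans:
  assumes "open_connected G \<eta> u v" "open_connected G \<eta> v w"
  shows "open_connected G \<eta> u w"
proof -
  interpret H: sym_digraph "open_subgraph G \<eta>" by (rule sym_digraph_open_subgraph)
  show ?thesis using assms H.reachable_trans by (auto simp: open_connected_iff_reachable)
qed

lemma open_connected_verts:
  assumes "open_connected G \<eta> u v"
  shows "u \<in> verts G" "\<eta> u" "v \<in> verts G" "\<eta> v"
proof -
  have "open_connected G \<eta> u u" "open_connected G \<eta> v v"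
    using assms by (meson open_connected_trans open_connected_sym)+
  then show "u \<in> verts G" "\<eta> u" "v \<in> verts G" "\<eta> v"
    by (simp_all add: open_connected_refl_iff)
qed

lemma open_connected_adj_trans:
  assumes "open_connected G \<eta> u x" "x \<rightarrow>\<^bsub>G\<^esub> y" "\<eta> y"
  shows "open_connected G \<eta> u y"
proof -
  interpret H: sym_digraph "open_subgraph G \<eta>" by (rule sym_digraph_open_subgraph)
  have "x \<rightarrow>\<^bsub>open_subgraph G \<eta>\<^esub> y"
    using assms open_connected_verts(4)[OF assms(1)] by (simp add: dominates_open_subgraph_iff)
  then show ?thesis
    using assms(1) H.reachable_adj_trans by (simp add: open_connected_iff_reachable)
qed

lemma open_connected_induct [consumes 1, case_names base step]:
  assumes "open_connected G \<eta> u v"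
    and "P u"
    and "\<And>x y. open_connected G \<eta> u x \<Longrightarrow> x \<rightarrow>\<^bsub>G\<^esub> y \<Longrightarrow> \<eta> y \<Longrightarrow> P x \<Longrightarrow> P y"
  shows "P v"
proof -
  interpret H: sym_digraph "open_subgraph G \<eta>" by (rule sym_digraph_open_subgraph)
  have "u \<rightarrow>\<^sup>*\<^bsub>open_subgraph G \<eta>\<^esub> v"
    using assms(1) by (simp add: open_connected_iff_reachable)
  then show ?thesis
    by (induction rule: H.reachable_induct)
      (auto simp: dominates_open_subgraph_iff open_connected_iff_reachable[symmetric] intro: assms(2,3))
qed

lemma open_connected_mono:
  assumes "open_connected G \<eta> u v" "\<And>x. \<eta> x \<Longrightarrow> \<eta>' x"
  shows "open_connected G \<eta>' u v"
  using assms by (auto simp: open_connected_def)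

lemma verts_open_clusters:
  "verts ` open_clusters G \<eta> = {{w. open_connected G \<eta> u w} |u. u \<in> verts G \<and> \<eta> u}"
proof -
  interpret H: sym_digraph "open_subgraph G \<eta>" by (rule sym_digraph_open_subgraph)
  have "H.scc_of u = {w. open_connected G \<eta> u w}" for u
    using H.symmetric_reachable' by (auto simp: H.scc_of_def open_connected_iff_reachable)
  then show ?thesis
    unfolding open_clusters_def H.sccs_verts_conv[symmetric] H.sccs_verts_conv_scc_of
    by (auto simp: verts_open_subgraph)
qed

lemma open_cluster_eq:
  assumes "C \<in> open_clusters G \<eta>" "u \<in> verts C"
  shows "verts C = {w. open_connected G \<eta> u w}"
proof -
  have "verts C \<in> verts ` open_clusters G \<eta>" using assms by blast
  then obtain x where x: "verts C = {w. open_connected G \<eta> x w}"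
    unfolding verts_open_clusters by blast
  then have "open_connected G \<eta> x u" using assms by simp
  then have "open_connected G \<eta> x w \<longleftrightarrow> open_connected G \<eta> u w" for w
    by (meson open_connected_trans open_connected_sym)
  then show ?thesis by (simp add: x)
qed

lemma connected_to_infinity_iff:
  "connected_to_infinity G \<eta> u \<longleftrightarrow> infinite {w. open_connected G \<eta> u w}"
proof
  assume "connected_to_infinity G \<eta> u"
  then obtain C where C: "C \<in> open_clusters G \<eta>" "infinite (verts C)" "u \<in> verts C"
    by (auto simp: connected_to_infinity_def infinite_open_cluster_def)
  then show "infinite {w. open_connected G \<eta> u w}" using open_cluster_eq by metis
next
  assume inf: "infinite {w. open_connected G \<eta> u w}"
  then obtain w where "open_connected G \<eta> u w"
    using not_finite_existsD by auto
  then have u: "open_connected G \<eta> u u" "u \<in> verts G" "\<eta> u"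
    using open_connected_verts[of \<eta> u w] by (simp_all add: open_connected_refl_iff)
  then have "{w. open_connected G \<eta> u w} \<in> verts ` open_clusters G \<eta>"
    unfolding verts_open_clusters by blast
  then show "connected_to_infinity G \<eta> u"
    using inf u by (auto simp: connected_to_infinity_def infinite_open_cluster_def)
qed

text \<open>
  Clusters are subgraphs here, but an induced subgraph is determined by its vertices, so that
  uniqueness of the infinite cluster can be expressed by connections between vertices.
\<close>

lemma unique_infinite_cluster_iff:
  "unique_infinite_cluster G \<eta> \<longleftrightarrow>
     (\<exists>u. connected_to_infinity G \<eta> u) \<and>
     (\<forall>u v. connected_to_infinity G \<eta> u \<longrightarrow> connected_to_infinity G \<eta> v \<longrightarrow> open_connected G \<eta> u v)"
  (is "?L \<longleftrightarrow> ?R")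
proof -
  interpret H: sym_digraph "open_subgraph G \<eta>" by (rule sym_digraph_open_subgraph)
  have inj: "inj_on verts (open_clusters G \<eta>)"
    unfolding open_clusters_def by (rule H.inj_on_verts_sccs)
  have nonempty: "\<exists>u. u \<in> verts C" if "infinite_open_cluster G \<eta> C" for C
    using that not_finite_existsD[of "\<lambda>u. u \<in> verts C"] by (auto simp: infinite_open_cluster_def)
  show ?thesis
  proof
    assume ?L
    then obtain C where C: "infinite_open_cluster G \<eta> C" and
      uniq: "\<And>C'. infinite_open_cluster G \<eta> C' \<Longrightarrow> C' = C"
      by (auto simp: unique_infinite_cluster_def)
    have "u \<in> verts C" if "connected_to_infinity G \<eta> u" for u
      using that uniq by (auto simp: connected_to_infinity_def)
    then show ?R
      using nonempty[OF C] C open_cluster_eq unfolding connected_to_infinity_def infinite_open_cluster_def by blast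
  next
    assume R: ?R
    then obtain C where C: "infinite_open_cluster G \<eta> C"
      by (auto simp: connected_to_infinity_def)
    moreover have "C' = C" if C': "infinite_open_cluster G \<eta> C'" for C'
    proof -
      obtain u v where uv: "u \<in> verts C" "v \<in> verts C'"
        using nonempty C C' by blast
      then have "open_connected G \<eta> u v"
        using R C C' unfolding connected_to_infinity_def by blast
      then have "v \<in> verts C" using open_cluster_eq[of C \<eta> u] C uv by (auto simp: infinite_open_cluster_def)
      then have "verts C' = verts C"
        using open_cluster_eq[of C \<eta> v] open_cluster_eq[of C' \<eta> v] C C' uv by (simp add: infinite_open_cluster_def)
      then show ?thesis
        using inj C C' by (auto simp: infinite_open_cluster_def inj_on_def)
    qed
    ultimately show ?L unfolding unique_infinite_cluster_def by blast
  qed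
qed

section \<open>Opening one vertex\<close>

lemma connected_to_infinity_mono:
  assumes "connected_to_infinity G \<eta> u" "\<And>x. \<eta> x \<Longrightarrow> \<eta>' x"
  shows "connected_to_infinity G \<eta>' u"
proof -
  have "{w. open_connected G \<eta> u w} \<subseteq> {w. open_connected G \<eta>' u w}"
    using assms(2) by (auto intro: open_connected_mono)
  then show ?thesis
    using assms(1) infinite_super by (auto simp: connected_to_infinity_iff)
qed

lemma finite_neighbours:
  assumes "locally_finite G"
  shows "finite {y. x \<rightarrow>\<^bsub>G\<^esub> y}"
proof (cases "x \<in> verts G")
  case True
  have "{y. x \<rightarrow>\<^bsub>G\<^esub> y} = head G ` out_arcs G x"
    by (auto simp: arcs_ends_conv out_arcs_def)
  then show ?thesis using assms True by (simp add: locally_finite_def)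
next
  case False
  then have "{y. x \<rightarrow>\<^bsub>G\<^esub> y} = {}" using adj_in_verts by blast
  then show ?thesis by simp
qed

text \<open>
  The new cluster of \<open>a\<close> is covered by \<open>x\<close>, the old cluster of \<open>a\<close> and the old clusters of the
  neighbours of \<open>x\<close> that it contains.  These are finitely many sets, so one of them is infinite.
\<close>

lemma infinite_cluster_before_opening:
  assumes lf: "locally_finite G" and inf: "connected_to_infinity G (\<eta>(x := True)) a"
  shows "\<exists>c. open_connected G (\<eta>(x := True)) a c \<and> connected_to_infinity G \<eta> c"
proof -
  let ?\<eta>' = "\<eta>(x := True)"
  let ?Z = "{z \<in> insert a {y. x \<rightarrow>\<^bsub>G\<^esub> y}. open_connected G ?\<eta>' a z}"
  have cover: "w = x \<or> (\<exists>z \<in> ?Z. open_connected G \<eta> z w)" if "open_connected G ?\<eta>' a w" for w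
    using that
  proof (induction rule: open_connected_induct)
    case base
    have "open_connected G ?\<eta>' a a" "a \<in> verts G" "?\<eta>' a"
      using open_connected_verts[OF that] by (simp_all add: open_connected_refl_iff)
    then show ?case by (auto simp: open_connected_refl_iff)
  next
    case (step w w')
    have w': "open_connected G ?\<eta>' a w'"
      by (rule open_connected_adj_trans) (rule step)+
    show ?case
    proof (cases "w' = x")
      case False
      then have "\<eta> w'" using step by simp
      show ?thesis
      proof (cases "w = x")
        case True
        then have "w' \<in> ?Z" using step w' by simp
        moreover have "open_connected G \<eta> w' w'"
          using \<open>\<eta> w'\<close> open_connected_verts[OF w'] by (simp add: open_connected_refl_iff)
        ultimately show ?thesis by blast
      next
        case False
        then obtain z where z: "z \<in> ?Z" "open_connected G \<eta> z w" using step by blast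
        have "open_connected G \<eta> z w'"
          by (rule open_connected_adj_trans[OF z(2) step(2) \<open>\<eta> w'\<close>])
        with z show ?thesis by blast
      qed
    qed simp
  qed
  have "{w. open_connected G ?\<eta>' a w} \<subseteq> insert x (\<Union>z \<in> ?Z. {w. open_connected G \<eta> z w})"
    (is "_ \<subseteq> insert x ?U") using cover by blast
  moreover have "infinite {w. open_connected G ?\<eta>' a w}"
    using inf by (simp add: connected_to_infinity_iff)
  ultimately have "infinite ?U"
    using infinite_super[of _ "insert x ?U"] by simp
  moreover have "finite ?Z" using finite_neighbours[OF lf, of x] by simp
  ultimately have "\<exists>z \<in> ?Z. infinite {w. open_connected G \<eta> z w}"
    using finite_UN_I[of ?Z "\<lambda>z. {w. open_connected G \<eta> z w}"] by blast
  then show ?thesis by (auto simp: connected_to_infinity_iff)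
qed

text \<open>
  New infinite clusters contain vertices of old infinite clusters, and the latter are all connected.
\<close>

lemma unique_infinite_cluster_opening:
  assumes lf: "locally_finite G" and uniq: "unique_infinite_cluster G \<eta>"
  shows "unique_infinite_cluster G (\<eta>(x := True))"
  unfolding unique_infinite_cluster_iff
proof (intro conjI allI impI)
  let ?\<eta>' = "\<eta>(x := True)"
  show "\<exists>u. connected_to_infinity G ?\<eta>' u"
  proof -
    obtain u where "connected_to_infinity G \<eta> u"
      using uniq by (auto simp: unique_infinite_cluster_iff)
    then have "connected_to_infinity G ?\<eta>' u"
      by (rule connected_to_infinity_mono) simp
    then show ?thesis by blast
  qed
  fix a b assume "connected_to_infinity G ?\<eta>' a" "connected_to_infinity G ?\<eta>' b"
  then obtain c d where c: "open_connected G ?\<eta>' a c" "connected_to_infinity G \<eta> c"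
    and d: "open_connected G ?\<eta>' b d" "connected_to_infinity G \<eta> d"
    using infinite_cluster_before_opening[OF lf] by blast
  have "open_connected G \<eta> c d"
    using uniq c d by (simp add: unique_infinite_cluster_iff)
  then have "open_connected G ?\<eta>' c d"
    by (rule open_connected_mono) simp
  then show "open_connected G ?\<eta>' a b"
    using c d open_connected_trans open_connected_sym by meson
qed

section \<open>Measurability\<close>

text \<open>
  Finitely many vertices can be reached from a root in exactly \<open>n\<close> steps.
\<close>

lemma countable_verts:
  assumes lf: "locally_finite G" and conn: "Digraph_Component.connected G"
  shows "countable (verts G)"
proof -
  have sc: "strongly_connected G"
    using symmetric_connected_imp_strongly_connected[OF sym_arcs conn] .
  then obtain r where r: "r \<in> verts G" by (auto simp: strongly_connected_def)
  have fin: "finite {y. (r, y) \<in> arcs_ends G ^^ n}" for n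
  proof (induction n)
    case (Suc n)
    have "{y. (r, y) \<in> arcs_ends G ^^ Suc n} = (\<Union>x \<in> {y. (r, y) \<in> arcs_ends G ^^ n}. {y. x \<rightarrow>\<^bsub>G\<^esub> y})"
      by auto
    then show ?case using Suc finite_neighbours[OF lf] by simp
  qed simp
  have "verts G \<subseteq> (\<Union>n. {y. (r, y) \<in> arcs_ends G ^^ n})"
  proof
    fix y assume "y \<in> verts G"
    then have "r \<rightarrow>\<^sup>* y" using sc r by (auto simp: strongly_connected_def)
    then have "(r, y) \<in> (arcs_ends G)\<^sup>*" by (rule reachable_rtranclI)
    then show "y \<in> (\<Union>n. {y. (r, y) \<in> arcs_ends G ^^ n})" using rtrancl_imp_relpow by fastforce
  qed
  moreover have "countable (\<Union>n. {y. (r, y) \<in> arcs_ends G ^^ n})"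
    using fin by (intro countable_UN) (auto intro: countable_finite)
  ultimately show ?thesis by (rule countable_subset)
qed

context
  fixes p :: real
  assumes countable_verts_G: "countable (verts G)"
begin

lemma measurable_open [measurable]:
  assumes "v \<in> verts G"
  shows "Measurable.pred (site_percolation G p) (\<lambda>\<eta>. \<eta> v)"
proof -
  have "(\<lambda>\<eta>. \<eta> v) \<in> site_percolation G p \<rightarrow>\<^sub>M measure_pmf (bernoulli_pmf p)"
    unfolding site_percolation_def using assms by (rule measurable_component_singleton)
  then show ?thesis by simp
qed

lemma measurable_open_connected [measurable]:
  "Measurable.pred (site_percolation G p) (\<lambda>\<eta>. open_connected G \<eta> u v)"
proof -
  let ?S = "(\<lambda>q. set (awalk_verts u q)) ` {q. apath u q v}"
  have "set (awalk_verts u q) \<subseteq> verts G" if "apath u q v" for q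
    using awalkI_apath[OF that] by (rule awalkE)
  then have sub: "?S \<subseteq> {S. finite S \<and> S \<subseteq> verts G}"
    by blast
  have count: "countable ?S"
    by (rule countable_subset[OF sub countable_Collect_finite_subset[OF countable_verts_G]])
  \<comment> \<open>The union ranges over the vertex sets of the paths: these are finite subsets of a countable set.\<close>
  have "open_connected G \<eta> u v \<longleftrightarrow> (\<exists>S\<in>?S. \<forall>x\<in>S. \<eta> x)" for \<eta>
    by (auto simp: open_connected_def)
  moreover have "Measurable.pred (site_percolation G p) (\<lambda>\<eta>. \<exists>S\<in>?S. \<forall>x\<in>S. \<eta> x)"
  proof (rule measurable_pred_countable(2)[OF count])
    fix S assume "S \<in> ?S"
    then have "finite S" "S \<subseteq> verts G" using sub by blast+
    then show "Measurable.pred (site_percolation G p) (\<lambda>\<eta>. \<forall>x\<in>S. \<eta> x)"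
      by (intro pred_intros_finite(3) measurable_open) auto
  qed
  ultimately show ?thesis by simp
qed

text \<open>
  The cluster of \<open>u\<close> is infinite iff it leaves every finite set of vertices, of which there are
  countably many.
\<close>

lemma measurable_connected_to_infinity [measurable]:
  "Measurable.pred (site_percolation G p) (\<lambda>\<eta>. connected_to_infinity G \<eta> u)"
proof -
  have "connected_to_infinity G \<eta> u \<longleftrightarrow>
    (\<forall>F \<in> {F. finite F \<and> F \<subseteq> verts G}. \<exists>w \<in> verts G - F. open_connected G \<eta> u w)" for \<eta>
  proof -
    have sub: "{w. open_connected G \<eta> u w} \<subseteq> verts G" using open_connected_verts by blast
    have "infinite X \<longleftrightarrow> (\<forall>F. finite F \<and> F \<subseteq> verts G \<longrightarrow> (\<exists>w \<in> verts G - F. w \<in> X))"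
      if "X \<subseteq> verts G" for X
      using that by (meson Diff_iff finite_subset subsetI subset_iff)
    from this[OF sub] show ?thesis by (simp add: connected_to_infinity_iff)
  qed
  moreover have "Measurable.pred (site_percolation G p)
    (\<lambda>\<eta>. \<forall>F \<in> {F. finite F \<and> F \<subseteq> verts G}. \<exists>w \<in> verts G - F. open_connected G \<eta> u w)"
    using countable_verts_G
    by (intro measurable_pred_countable measurable_open_connected countable_Collect_finite_subset countable_Diff)
  ultimately show ?thesis by simp
qed

lemma measurable_unique_infinite_cluster [measurable]:
  "Measurable.pred (site_percolation G p) (\<lambda>\<eta>. unique_infinite_cluster G \<eta>)"
proof -
  have V: "u \<in> verts G" if "connected_to_infinity G \<eta> u" for \<eta> u
    using that open_connected_verts not_finite_existsD[of "open_connected G \<eta> u"]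
    by (auto simp: connected_to_infinity_iff)
  have "unique_infinite_cluster G \<eta> \<longleftrightarrow> (\<exists>u \<in> verts G. connected_to_infinity G \<eta> u) \<and>
     (\<forall>u \<in> verts G. \<forall>v \<in> verts G. connected_to_infinity G \<eta> u \<longrightarrow> connected_to_infinity G \<eta> v \<longrightarrow>
        open_connected G \<eta> u v)" for \<eta>
    unfolding unique_infinite_cluster_iff using V by blast
  moreover have "Measurable.pred (site_percolation G p) (\<lambda>\<eta>. (\<exists>u \<in> verts G. connected_to_infinity G \<eta> u) \<and>
     (\<forall>u \<in> verts G. \<forall>v \<in> verts G. connected_to_infinity G \<eta> u \<longrightarrow> connected_to_infinity G \<eta> v \<longrightarrow>
        open_connected G \<eta> u v))"
    using countable_verts_G
    by (intro pred_intros_logic measurable_pred_countable measurable_open_connected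
        measurable_connected_to_infinity)
  ultimately show ?thesis by simp
qed

end

end

theorem proposition1p3:
  fixes G :: "('a, 'b) pre_digraph" and p :: real and u v :: 'a
  assumes "sym_digraph G"
    and "infinite (verts G)"
    and "Digraph_Component.connected G"
    and "locally_finite G"
    and "0 \<le> p" and "p \<le> 1"
    and "u \<in> verts G" and "v \<in> verts G"
  shows "\<P>(\<omega> in site_percolation G p. open_connected G \<omega> u v) \<ge>
         \<P>(\<omega> in site_percolation G p. connected_to_infinity G \<omega> u) *
         \<P>(\<omega> in site_percolation G p. connected_to_infinity G \<omega> v) *
         \<P>(\<omega> in site_percolation G p. unique_infinite_cluster G \<omega>)"
proof -
  interpret G: sym_digraph G by fact
  have count: "countable (verts G)"
    by (rule G.countable_verts) fact+
  interpret B: bernoulli_product "verts G" p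
    by unfold_locales (use assms count in auto)
  have M: "site_percolation G p = B.M"
    by (simp add: site_percolation_def B.M_def)
  note [measurable] = G.measurable_open_connected[OF count, where p = p, unfolded M]
    G.measurable_connected_to_infinity[OF count, where p = p, unfolded M]
    G.measurable_unique_infinite_cluster[OF count, where p = p, unfolded M]
  define A where "A w = {\<omega> \<in> space B.M. connected_to_infinity G \<omega> w}" for w
  define U where "U = {\<omega> \<in> space B.M. unique_infinite_cluster G \<omega>}"
  have meas: "A w \<in> sets B.M" "U \<in> sets B.M" for w
    unfolding A_def U_def by measurable
  have A: "B.closed_under_opening (A w)" for w
    using G.connected_to_infinity_mono[of _ w]
    by (auto simp: B.closed_under_opening_def A_def B.fun_upd_in_space)
  have U: "B.closed_under_opening U"
    using G.unique_infinite_cluster_opening[OF \<open>locally_finite G\<close>]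
    by (auto simp: B.closed_under_opening_def U_def B.fun_upd_in_space)
  have AA: "B.closed_under_opening (A u \<inter> A v)"
    using A by (auto simp: B.closed_under_opening_def)
  have "B.prob (A u) * B.prob (A v) * B.prob U \<le> B.prob (A u \<inter> A v) * B.prob U"
    by (intro mult_right_mono B.harris_inequality meas A) simp
  also have "\<dots> \<le> B.prob (A u \<inter> A v \<inter> U)"
    by (intro B.harris_inequality sets.Int meas AA U)
  also have "\<dots> \<le> B.prob {\<omega> \<in> space B.M. open_connected G \<omega> u v}"
    by (rule B.finite_measure_mono) (auto simp: A_def U_def G.unique_infinite_cluster_iff)
  finally show ?thesis
    by (simp add: M A_def U_def)
qed

end
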